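(* Let $R$ be a ring such that every quasi sdf-absorbing ideal of $R$ is an sdf-absorbing primary ideal of $R$. Then for any multiplicative subset $S\subseteq R$, every quasi sdf-absorbing ideal of $S^{-1}R$ is an sdf-absorbing primary ideal of $S^{-1}R$.
   Context: All rings are commutative with identity. An ideal $I$ of a ring $R$ is called sdf-absorbing if for all non-zero $a,b\in R$, $a^{2}-b^{2}\in I$ implies $a-b\in I$ or $a+b\in I$. A proper ideal $I$ of $R$ is called quasi sdf-absorbing if its radical $\sqrt{I}$ is an sdf-absorbing ideal of $R$. An ideal $I$ of $R$ is called sdf-absorbing primary if for all $a,b\in R$, $a^{2}-b^{2}\in I$ implies $a+b\in\sqrt{I}$ or $a-b\in I$. *)

theory Defs
  imports "HOL-Algebra.RingHom"
begin

section \<open>Localization at a multiplicative subset\<close>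

text \<open>
  A multiplicative subset is a submonoid of the multiplicative monoid of \<open>R\<close>, that is
  \<open>submonoid S R\<close>. It may contain zero, and then the localization is the zero ring.
  Fractions are equivalence classes of pairs in \<open>carrier R \<times> S\<close>, where \<open>r/s = r'/s'\<close> iff
  \<open>u (r s' - r' s) = 0\<close> for some \<open>u \<in> S\<close>; the factor \<open>u\<close> is needed because \<open>R\<close> may have zero
  divisors.
\<close>

definition loc_rel :: "('a, 'b) ring_scheme \<Rightarrow> 'a set \<Rightarrow> (('a \<times> 'a) \<times> ('a \<times> 'a)) set"
  where "loc_rel R S =
    {((r, s), (r', s')). r \<in> carrier R \<and> s \<in> S \<and> r' \<in> carrier R \<and> s' \<in> S \<and>
      (\<exists>u\<in>S. u \<otimes>\<^bsub>R\<^esub> (r \<otimes>\<^bsub>R\<^esub> s' \<ominus>\<^bsub>R\<^esub> r' \<otimes>\<^bsub>R\<^esub> s) = \<zero>\<^bsub>R\<^esub>)}"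

definition loc_frac :: "('a, 'b) ring_scheme \<Rightarrow> 'a set \<Rightarrow> 'a \<Rightarrow> 'a \<Rightarrow> ('a \<times> 'a) set"
  where "loc_frac R S r s = loc_rel R S `` {(r, s)}"

text \<open>
  The operations are given on all representatives at once; the unions below collapse to
  a single fraction, see \<open>mult_frac\<close> and \<open>add_frac\<close>.
\<close>

definition localization :: "('a, 'b) ring_scheme \<Rightarrow> 'a set \<Rightarrow> ('a \<times> 'a) set ring"
  where "localization R S =
    \<lparr>carrier = (carrier R \<times> S) // loc_rel R S,
     mult = (\<lambda>X Y. \<Union>(a, s)\<in>X. \<Union>(b, t)\<in>Y. loc_frac R S (a \<otimes>\<^bsub>R\<^esub> b) (s \<otimes>\<^bsub>R\<^esub> t)),
     one = loc_frac R S \<one>\<^bsub>R\<^esub> \<one>\<^bsub>R\<^esub>,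
     zero = loc_frac R S \<zero>\<^bsub>R\<^esub> \<one>\<^bsub>R\<^esub>,
     add = (\<lambda>X Y. \<Union>(a, s)\<in>X. \<Union>(b, t)\<in>Y.
              loc_frac R S (a \<otimes>\<^bsub>R\<^esub> t \<oplus>\<^bsub>R\<^esub> b \<otimes>\<^bsub>R\<^esub> s) (s \<otimes>\<^bsub>R\<^esub> t))\<rparr>"

locale cring_mult_subset = cring R + submonoid S R for R (structure) and S
begin

lemma S_carrier: "s \<in> S \<Longrightarrow> s \<in> carrier R"
  by (rule mem_carrier)

lemma minus_eq_zero_iff:
  assumes "x \<in> carrier R" "y \<in> carrier R"
  shows "x \<ominus> y = \<zero> \<longleftrightarrow> x = y"
proof
  assume "x \<ominus> y = \<zero>"
  moreover have "x = (x \<ominus> y) \<oplus> y"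
    using assms by algebra
  ultimately show "x = y"
    using assms by simp
qed (use assms r_neg in \<open>simp add: minus_eq\<close>)

lemma loc_rel_iff:
  "((r, s), (r', s')) \<in> loc_rel R S \<longleftrightarrow>
    r \<in> carrier R \<and> s \<in> S \<and> r' \<in> carrier R \<and> s' \<in> S \<and>
    (\<exists>u\<in>S. u \<otimes> (r \<otimes> s') = u \<otimes> (r' \<otimes> s))"
proof -
  have "u \<otimes> (r \<otimes> s' \<ominus> r' \<otimes> s) = \<zero> \<longleftrightarrow> u \<otimes> (r \<otimes> s') = u \<otimes> (r' \<otimes> s)"
    if "u \<in> S" "r \<in> carrier R" "s \<in> S" "r' \<in> carrier R" "s' \<in> S" for u
  proof -
    have c: "u \<in> carrier R" "s \<in> carrier R" "s' \<in> carrier R"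
      using that S_carrier by auto
    then have "u \<otimes> (r \<otimes> s' \<ominus> r' \<otimes> s) = u \<otimes> (r \<otimes> s') \<ominus> u \<otimes> (r' \<otimes> s)"
      using that by algebra
    then show ?thesis
      using that c minus_eq_zero_iff by simp
  qed
  then show ?thesis
    unfolding loc_rel_def by blast
qed

lemma equiv_loc_rel: "equiv (carrier R \<times> S) (loc_rel R S)"
proof (rule equivI)
  show "loc_rel R S \<subseteq> (carrier R \<times> S) \<times> (carrier R \<times> S)"
    unfolding loc_rel_def by auto
  show "refl_on (carrier R \<times> S) (loc_rel R S)"
    unfolding refl_on_def by (auto simp: loc_rel_iff)
  show "sym (loc_rel R S)"
    by (rule symI) (clarsimp simp: loc_rel_iff, metis)
  show "trans (loc_rel R S)"
  proof (rule transI, clarify)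
    fix a s b t c v
    assume "((a, s), (b, t)) \<in> loc_rel R S" "((b, t), (c, v)) \<in> loc_rel R S"
    then obtain u w where *: "u \<in> S" "w \<in> S" "u \<otimes> (a \<otimes> t) = u \<otimes> (b \<otimes> s)"
      "w \<otimes> (b \<otimes> v) = w \<otimes> (c \<otimes> t)" "a \<in> carrier R" "b \<in> carrier R" "c \<in> carrier R"
      "s \<in> S" "t \<in> S" "v \<in> S"
      by (auto simp: loc_rel_iff)
    then have c: "u \<in> carrier R" "w \<in> carrier R" "s \<in> carrier R" "t \<in> carrier R" "v \<in> carrier R"
      using S_carrier by auto
    have "(u \<otimes> w \<otimes> t) \<otimes> (a \<otimes> v) = (u \<otimes> (a \<otimes> t)) \<otimes> (w \<otimes> v)"
      using *(5-7) c by algebra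
    also have "\<dots> = (w \<otimes> (b \<otimes> v)) \<otimes> (u \<otimes> s)"
      unfolding *(3) using *(5-7) c by algebra
    also have "\<dots> = (u \<otimes> w \<otimes> t) \<otimes> (c \<otimes> s)"
      unfolding *(4) using *(5-7) c by algebra
    finally show "((a, s), (c, v)) \<in> loc_rel R S"
      using * m_closed by (auto simp: loc_rel_iff)
  qed
qed

lemma frac_eq_iff:
  assumes "a \<in> carrier R" "s \<in> S" "b \<in> carrier R" "t \<in> S"
  shows "loc_frac R S a s = loc_frac R S b t \<longleftrightarrow> (\<exists>u\<in>S. u \<otimes> (a \<otimes> t) = u \<otimes> (b \<otimes> s))"
  using assms eq_equiv_class_iff[OF equiv_loc_rel, of "(a, s)" "(b, t)"]
  by (simp add: loc_frac_def loc_rel_iff)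

lemma carrier_localization:
  "carrier (localization R S) = {loc_frac R S a s | a s. a \<in> carrier R \<and> s \<in> S}"
  by (auto simp: localization_def loc_frac_def quotient_def)

lemma mult_frac:
  assumes "a \<in> carrier R" "s \<in> S" "b \<in> carrier R" "t \<in> S"
  shows "loc_frac R S a s \<otimes>\<^bsub>localization R S\<^esub> loc_frac R S b t = loc_frac R S (a \<otimes> b) (s \<otimes> t)"
proof -
  have "congruent2 (loc_rel R S) (loc_rel R S) (\<lambda>(a, s) (b, t). loc_frac R S (a \<otimes> b) (s \<otimes> t))"
  proof (rule congruent2I', clarify)
    fix a s a' s' b t b' t'
    assume "((a, s), (a', s')) \<in> loc_rel R S" "((b, t), (b', t')) \<in> loc_rel R S"
    then obtain u w where *: "u \<in> S" "w \<in> S" "u \<otimes> (a \<otimes> s') = u \<otimes> (a' \<otimes> s)"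
      "w \<otimes> (b \<otimes> t') = w \<otimes> (b' \<otimes> t)" "a \<in> carrier R" "a' \<in> carrier R" "b \<in> carrier R"
      "b' \<in> carrier R" and S: "s \<in> S" "s' \<in> S" "t \<in> S" "t' \<in> S"
      by (auto simp: loc_rel_iff)
    then have c: "u \<in> carrier R" "w \<in> carrier R" "s \<in> carrier R" "s' \<in> carrier R"
      "t \<in> carrier R" "t' \<in> carrier R"
      using S_carrier by auto
    have "(u \<otimes> w) \<otimes> ((a \<otimes> b) \<otimes> (s' \<otimes> t')) = (u \<otimes> (a \<otimes> s')) \<otimes> (w \<otimes> (b \<otimes> t'))"
      using *(5-8) c by algebra
    also have "\<dots> = (u \<otimes> w) \<otimes> ((a' \<otimes> b') \<otimes> (s \<otimes> t))"
      unfolding *(3,4) using *(5-8) c by algebra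
    finally show "loc_frac R S (a \<otimes> b) (s \<otimes> t) = loc_frac R S (a' \<otimes> b') (s' \<otimes> t')"
      using * S m_closed by (subst frac_eq_iff) auto
  qed
  from UN_equiv_class2[OF equiv_loc_rel equiv_loc_rel this, of "(a, s)" "(b, t)"] assms
  show ?thesis
    by (simp add: localization_def loc_frac_def case_prod_unfold)
qed

lemma add_frac:
  assumes "a \<in> carrier R" "s \<in> S" "b \<in> carrier R" "t \<in> S"
  shows "loc_frac R S a s \<oplus>\<^bsub>localization R S\<^esub> loc_frac R S b t = loc_frac R S (a \<otimes> t \<oplus> b \<otimes> s) (s \<otimes> t)"
proof -
  have "congruent2 (loc_rel R S) (loc_rel R S)
    (\<lambda>(a, s) (b, t). loc_frac R S (a \<otimes> t \<oplus> b \<otimes> s) (s \<otimes> t))"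
  proof (rule congruent2I', clarify)
    fix a s a' s' b t b' t'
    assume "((a, s), (a', s')) \<in> loc_rel R S" "((b, t), (b', t')) \<in> loc_rel R S"
    then obtain u w where *: "u \<in> S" "w \<in> S" "u \<otimes> (a \<otimes> s') = u \<otimes> (a' \<otimes> s)"
      "w \<otimes> (b \<otimes> t') = w \<otimes> (b' \<otimes> t)" "a \<in> carrier R" "a' \<in> carrier R" "b \<in> carrier R"
      "b' \<in> carrier R" and S: "s \<in> S" "s' \<in> S" "t \<in> S" "t' \<in> S"
      by (auto simp: loc_rel_iff)
    then have c: "u \<in> carrier R" "w \<in> carrier R" "s \<in> carrier R" "s' \<in> carrier R"
      "t \<in> carrier R" "t' \<in> carrier R"
      using S_carrier by auto
    have "(u \<otimes> w) \<otimes> ((a \<otimes> t \<oplus> b \<otimes> s) \<otimes> (s' \<otimes> t')) =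
        (u \<otimes> (a \<otimes> s')) \<otimes> (w \<otimes> t \<otimes> t') \<oplus> (w \<otimes> (b \<otimes> t')) \<otimes> (u \<otimes> s \<otimes> s')"
      using *(5-8) c by algebra
    also have "\<dots> = (u \<otimes> w) \<otimes> ((a' \<otimes> t' \<oplus> b' \<otimes> s') \<otimes> (s \<otimes> t))"
      unfolding *(3,4) using *(5-8) c by algebra
    finally show "loc_frac R S (a \<otimes> t \<oplus> b \<otimes> s) (s \<otimes> t) = loc_frac R S (a' \<otimes> t' \<oplus> b' \<otimes> s') (s' \<otimes> t')"
      using * S c m_closed by (subst frac_eq_iff) auto
  qed
  from UN_equiv_class2[OF equiv_loc_rel equiv_loc_rel this, of "(a, s)" "(b, t)"] assms
  show ?thesis
    by (simp add: localization_def loc_frac_def case_prod_unfold)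
qed

lemma one_localization: "\<one>\<^bsub>localization R S\<^esub> = loc_frac R S \<one> \<one>"
  by (simp add: localization_def)

lemma zero_localization: "\<zero>\<^bsub>localization R S\<^esub> = loc_frac R S \<zero> \<one>"
  by (simp add: localization_def)

lemma frac_cong:
  assumes "a \<in> carrier R" "s \<in> S" "b \<in> carrier R" "t \<in> S" "a \<otimes> t = b \<otimes> s"
  shows "loc_frac R S a s = loc_frac R S b t"
  using assms by (subst frac_eq_iff) auto

lemma frac_closed: "a \<in> carrier R \<Longrightarrow> s \<in> S \<Longrightarrow> loc_frac R S a s \<in> carrier (localization R S)"
  by (auto simp: carrier_localization)

lemma cring_localization: "cring (localization R S)"
proof -
  let ?L = "localization R S"
  have abelian: "abelian_group ?L"
  proof (rule abelian_groupI; unfold carrier_localization; clarify?)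
    fix a s b t
    assume *: "a \<in> carrier R" "s \<in> S" "b \<in> carrier R" "t \<in> S"
    then have c: "s \<in> carrier R" "t \<in> carrier R"
      using S_carrier by auto
    show "\<exists>a' s'. loc_frac R S a s \<oplus>\<^bsub>?L\<^esub> loc_frac R S b t = loc_frac R S a' s' \<and> a' \<in> carrier R \<and> s' \<in> S"
      using * c by (fastforce simp: add_frac)
    show "loc_frac R S a s \<oplus>\<^bsub>?L\<^esub> loc_frac R S b t = loc_frac R S b t \<oplus>\<^bsub>?L\<^esub> loc_frac R S a s"
      using * c by (simp add: add_frac a_comm m_comm)
    fix d v
    assume **: "d \<in> carrier R" "v \<in> S"
    then have v: "v \<in> carrier R"
      using S_carrier by auto
    have "(a \<otimes> t \<oplus> b \<otimes> s) \<otimes> v \<oplus> d \<otimes> (s \<otimes> t) = a \<otimes> (t \<otimes> v) \<oplus> (b \<otimes> v \<oplus> d \<otimes> t) \<otimes> s"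
      using *(1,3) **(1) c v by algebra
    then show "loc_frac R S a s \<oplus>\<^bsub>?L\<^esub> loc_frac R S b t \<oplus>\<^bsub>?L\<^esub> loc_frac R S d v =
        loc_frac R S a s \<oplus>\<^bsub>?L\<^esub> (loc_frac R S b t \<oplus>\<^bsub>?L\<^esub> loc_frac R S d v)"
      using * ** c v by (simp add: add_frac m_assoc)
  next
    fix a s
    assume *: "a \<in> carrier R" "s \<in> S"
    then have c: "s \<in> carrier R"
      using S_carrier by auto
    show "\<zero>\<^bsub>?L\<^esub> \<oplus>\<^bsub>?L\<^esub> loc_frac R S a s = loc_frac R S a s"
      using * c by (simp add: zero_localization add_frac)
    have "loc_frac R S (\<ominus> a \<otimes> s \<oplus> a \<otimes> s) (s \<otimes> s) = loc_frac R S \<zero> \<one>"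
    proof (rule frac_cong)
      show "(\<ominus> a \<otimes> s \<oplus> a \<otimes> s) \<otimes> \<one> = \<zero> \<otimes> (s \<otimes> s)"
        using *(1) c by algebra
    qed (use * c in auto)
    then have "loc_frac R S (\<ominus> a) s \<oplus>\<^bsub>?L\<^esub> loc_frac R S a s = \<zero>\<^bsub>?L\<^esub>"
      using * by (simp add: add_frac zero_localization)
    then show "\<exists>y\<in>{loc_frac R S a s |a s. a \<in> carrier R \<and> s \<in> S}. y \<oplus>\<^bsub>?L\<^esub> loc_frac R S a s = \<zero>\<^bsub>?L\<^esub>"
      using * by blast
  qed (unfold zero_localization, use zero_closed one_closed in blast)
  have monoid: "comm_monoid ?L"
  proof (rule comm_monoidI; unfold carrier_localization; clarify?)
    fix a s b t
    assume *: "a \<in> carrier R" "s \<in> S" "b \<in> carrier R" "t \<in> S"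
    then have c: "s \<in> carrier R" "t \<in> carrier R"
      using S_carrier by auto
    show "\<exists>a' s'. loc_frac R S a s \<otimes>\<^bsub>?L\<^esub> loc_frac R S b t = loc_frac R S a' s' \<and> a' \<in> carrier R \<and> s' \<in> S"
      using * by (fastforce simp: mult_frac)
    show "loc_frac R S a s \<otimes>\<^bsub>?L\<^esub> loc_frac R S b t = loc_frac R S b t \<otimes>\<^bsub>?L\<^esub> loc_frac R S a s"
      using * c by (simp add: mult_frac m_comm)
    fix d v
    assume **: "d \<in> carrier R" "v \<in> S"
    then show "loc_frac R S a s \<otimes>\<^bsub>?L\<^esub> loc_frac R S b t \<otimes>\<^bsub>?L\<^esub> loc_frac R S d v =
        loc_frac R S a s \<otimes>\<^bsub>?L\<^esub> (loc_frac R S b t \<otimes>\<^bsub>?L\<^esub> loc_frac R S d v)"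
      using * c S_carrier by (simp add: mult_frac m_assoc)
  next
    fix a s
    assume "a \<in> carrier R" "s \<in> S"
    then show "\<one>\<^bsub>?L\<^esub> \<otimes>\<^bsub>?L\<^esub> loc_frac R S a s = loc_frac R S a s"
      using S_carrier by (simp add: one_localization mult_frac)
  qed (unfold one_localization, use zero_closed one_closed in blast)
  show ?thesis
  proof (rule cringI[OF abelian monoid]; unfold carrier_localization; clarify)
    fix a s b t d v
    assume *: "a \<in> carrier R" "s \<in> S" "b \<in> carrier R" "t \<in> S" "d \<in> carrier R" "v \<in> S"
    then have c: "s \<in> carrier R" "t \<in> carrier R" "v \<in> carrier R"
      using S_carrier by auto
    have "loc_frac R S ((a \<otimes> t \<oplus> b \<otimes> s) \<otimes> d) (s \<otimes> t \<otimes> v) =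
        loc_frac R S (a \<otimes> d \<otimes> (t \<otimes> v) \<oplus> b \<otimes> d \<otimes> (s \<otimes> v)) (s \<otimes> v \<otimes> (t \<otimes> v))"
    proof (rule frac_cong)
      show "(a \<otimes> t \<oplus> b \<otimes> s) \<otimes> d \<otimes> (s \<otimes> v \<otimes> (t \<otimes> v)) =
          (a \<otimes> d \<otimes> (t \<otimes> v) \<oplus> b \<otimes> d \<otimes> (s \<otimes> v)) \<otimes> (s \<otimes> t \<otimes> v)"
        using *(1,3,5) c by algebra
    qed (use * c in auto)
    then show "(loc_frac R S a s \<oplus>\<^bsub>?L\<^esub> loc_frac R S b t) \<otimes>\<^bsub>?L\<^esub> loc_frac R S d v =
        loc_frac R S a s \<otimes>\<^bsub>?L\<^esub> loc_frac R S d v \<oplus>\<^bsub>?L\<^esub> loc_frac R S b t \<otimes>\<^bsub>?L\<^esub> loc_frac R S d v"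
      using * c by (simp add: add_frac mult_frac)
  qed
qed

lemma ring_hom_localization: "(\<lambda>r. loc_frac R S r \<one>) \<in> ring_hom R (localization R S)"
  by (rule ring_hom_memI) (auto simp: frac_closed mult_frac add_frac one_localization)

lemma Units_localization:
  assumes "s \<in> S"
  shows "loc_frac R S s \<one> \<in> Units (localization R S)"
proof -
  have c: "s \<in> carrier R"
    using assms S_carrier by auto
  have "loc_frac R S s s = loc_frac R S \<one> \<one>"
    using assms c by (intro frac_cong) auto
  then have "loc_frac R S s \<one> \<otimes>\<^bsub>localization R S\<^esub> loc_frac R S \<one> s = \<one>\<^bsub>localization R S\<^esub>"
    "loc_frac R S \<one> s \<otimes>\<^bsub>localization R S\<^esub> loc_frac R S s \<one> = \<one>\<^bsub>localization R S\<^esub>"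
    using assms c by (simp_all add: mult_frac one_localization)
  then show ?thesis
    using assms c frac_closed[of s \<one>] frac_closed[of \<one> s] unfolding Units_def by auto
qed

end


section \<open>Square-difference factor absorbing ideals\<close>

definition radical :: "('a, 'b) ring_scheme \<Rightarrow> 'a set \<Rightarrow> 'a set"
  where "radical R I = {x \<in> carrier R. \<exists>n::nat. n > 0 \<and> x [^]\<^bsub>R\<^esub> n \<in> I}"

text \<open>
  Only quasi sdf-absorbing ideals are required to be proper. The restriction to non-zero
  \<open>a\<close> and \<open>b\<close> belongs to \<open>sdf_absorbing\<close> only, not to \<open>sdf_absorbing_primary\<close>.
\<close>

definition sdf_absorbing :: "'a set \<Rightarrow> ('a, 'b) ring_scheme \<Rightarrow> bool"
  where "sdf_absorbing I R \<longleftrightarrow> ideal I R \<and>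
    (\<forall>a\<in>carrier R - {\<zero>\<^bsub>R\<^esub>}. \<forall>b\<in>carrier R - {\<zero>\<^bsub>R\<^esub>}.
      a [^]\<^bsub>R\<^esub> (2::nat) \<ominus>\<^bsub>R\<^esub> b [^]\<^bsub>R\<^esub> (2::nat) \<in> I \<longrightarrow> a \<ominus>\<^bsub>R\<^esub> b \<in> I \<or> a \<oplus>\<^bsub>R\<^esub> b \<in> I)"

definition quasi_sdf_absorbing :: "'a set \<Rightarrow> ('a, 'b) ring_scheme \<Rightarrow> bool"
  where "quasi_sdf_absorbing I R \<longleftrightarrow>
    ideal I R \<and> I \<noteq> carrier R \<and> sdf_absorbing (radical R I) R"

definition sdf_absorbing_primary :: "'a set \<Rightarrow> ('a, 'b) ring_scheme \<Rightarrow> bool"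
  where "sdf_absorbing_primary I R \<longleftrightarrow> ideal I R \<and>
    (\<forall>a\<in>carrier R. \<forall>b\<in>carrier R.
      a [^]\<^bsub>R\<^esub> (2::nat) \<ominus>\<^bsub>R\<^esub> b [^]\<^bsub>R\<^esub> (2::nat) \<in> I \<longrightarrow>
      a \<oplus>\<^bsub>R\<^esub> b \<in> radical R I \<or> a \<ominus>\<^bsub>R\<^esub> b \<in> I)"

end

theory Submission
  imports Defs "HOL-Algebra.Multiplicative_Group" "HOL-Algebra.QuotRing"
begin

text \<open>
  The contraction \<open>I\<close> of an ideal \<open>J\<close> along \<open>R \<rightarrow> S\<^sup>-\<^sup>1R\<close> satisfies \<open>\<surd>I = R \<inter> \<surd>J\<close>, so it is quasi
  sdf-absorbing whenever \<open>J\<close> is; elements that the localization kills cause no trouble, because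
  for a radical ideal the sdf condition extends to zero arguments. Hence \<open>I\<close> is sdf-absorbing
  primary, and this passes back to \<open>J\<close> by clearing the denominators of two fractions with a
  common unit.
\<close>

text \<open>Multiplying by the inverse of \<open>u\<close> cancels it. This serves to remove a
  cleared denominator from a membership statement.\<close>

lemma (in ideal) Units_mult_memD:
  assumes "u \<in> Units R" "x \<in> carrier R" "u \<otimes> x \<in> I"
  shows "x \<in> I"
proof -
  have "inv u \<otimes> (u \<otimes> x) \<in> I"
    using assms I_l_closed by simp
  moreover have "inv u \<otimes> (u \<otimes> x) = x"
    using assms by (simp add: Units_closed m_assoc[symmetric])
  ultimately show ?thesis
    by simp
qed

context cring
begin

lemma radical_square_memD:
  assumes "x \<in> carrier R" "x [^] (2::nat) \<in> radical R I"
  shows "x \<in> radical R I"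
proof -
  obtain n :: nat where "n > 0" "x [^] (2 * n) \<in> I"
    using assms by (auto simp: radical_def nat_pow_pow)
  then show ?thesis
    using assms(1) unfolding radical_def by (auto intro!: exI[of _ "2 * n"])
qed

text \<open>If one argument is zero, the difference of squares is, up to sign, the square of the
  other. The radical then contains that other argument, which is also the sum.\<close>

lemma sdf_absorbing_radicalD:
  assumes sdf: "sdf_absorbing (radical R I) R"
    and ab: "a \<in> carrier R" "b \<in> carrier R"
    and diff: "a [^] (2::nat) \<ominus> b [^] (2::nat) \<in> radical R I"
  shows "a \<ominus> b \<in> radical R I \<or> a \<oplus> b \<in> radical R I"
proof -
  interpret K: ideal "radical R I" R
    using sdf by (simp add: sdf_absorbing_def)
  consider "a = \<zero>" | "b = \<zero>" | "a \<noteq> \<zero>" "b \<noteq> \<zero>"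
    by blast
  then show ?thesis
  proof cases
    case 1
    then have "\<ominus> (b [^] (2::nat)) \<in> radical R I"
      using diff ab by (simp add: minus_eq nat_pow_zero)
    then have "b [^] (2::nat) \<in> radical R I"
      using K.a_inv_closed[of "\<ominus> (b [^] (2::nat))"] ab by simp
    then show ?thesis
      using 1 ab radical_square_memD[OF ab(2)] by (simp add: minus_eq)
  next
    case 2
    then have "a [^] (2::nat) \<in> radical R I"
      using diff ab by (simp add: minus_eq nat_pow_zero)
    then show ?thesis
      using 2 ab radical_square_memD[OF ab(1)] by (simp add: minus_eq)
  next
    case 3
    then show ?thesis
      using sdf ab diff by (simp add: sdf_absorbing_def)
  qed
qed

end

context ring_hom_cring
begin

text \<open>Since \<open>h\<close> commutes with powers, the same exponent witnesses membership on
  both sides; \<open>J\<close> may be any set.\<close>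

lemma radical_vimage:
  "radical R {r \<in> carrier R. h r \<in> J} = {r \<in> carrier R. h r \<in> radical S J}"
  by (auto simp: radical_def)

lemma quasi_sdf_absorbing_vimage:
  assumes J: "quasi_sdf_absorbing J S"
  shows "quasi_sdf_absorbing {r \<in> carrier R. h r \<in> J} R"
proof -
  have sdf: "sdf_absorbing (radical S J) S" and J': "ideal J S" "J \<noteq> carrier S"
    using J by (auto simp: quasi_sdf_absorbing_def)
  have "\<one>\<^bsub>S\<^esub> \<notin> J"
    using J' ideal.one_imp_carrier by blast
  then have "{r \<in> carrier R. h r \<in> J} \<noteq> carrier R"
    using R.one_closed hom_one by force
  \<comment> \<open>A non-zero element of \<open>R\<close> may have image zero in \<open>S\<close>,
    so the definition alone does not apply to the images; the version admitting zero arguments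
    does.\<close>
  moreover have "sdf_absorbing {r \<in> carrier R. h r \<in> radical S J} R"
    using S.sdf_absorbing_radicalD[OF sdf] sdf
    by (auto simp: sdf_absorbing_def ring.ideal_vimage)
  ultimately show ?thesis
    by (simp add: quasi_sdf_absorbing_def radical_vimage ring.ideal_vimage J')
qed

text \<open>The assumption \<open>denom\<close> captures what a localization contributes: one unit
  moves both elements into the image of \<open>h\<close>. It has to be the same unit, so that the
  sum and the difference scale by it as well.\<close>

lemma sdf_absorbing_primary_if_vimage:
  assumes J: "ideal J S" "ideal (radical S J) S"
    and I: "sdf_absorbing_primary {r \<in> carrier R. h r \<in> J} R"
    and denom: "\<And>x y. x \<in> carrier S \<Longrightarrow> y \<in> carrier S \<Longrightarrow>
      \<exists>u\<in>Units S. \<exists>a\<in>carrier R. \<exists>b\<in>carrier R. u \<otimes>\<^bsub>S\<^esub> x = h a \<and> u \<otimes>\<^bsub>S\<^esub> y = h b"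
  shows "sdf_absorbing_primary J S"
  unfolding sdf_absorbing_primary_def
proof (intro conjI ballI impI)
  fix x y
  assume xy: "x \<in> carrier S" "y \<in> carrier S"
    and diff: "x [^]\<^bsub>S\<^esub> (2::nat) \<ominus>\<^bsub>S\<^esub> y [^]\<^bsub>S\<^esub> (2::nat) \<in> J"
  obtain u a b where u: "u \<in> Units S" and ab: "a \<in> carrier R" "b \<in> carrier R"
    and eq: "h a = u \<otimes>\<^bsub>S\<^esub> x" "h b = u \<otimes>\<^bsub>S\<^esub> y"
    using denom[OF xy] by metis
  have uc: "u \<in> carrier S"
    using u by (rule S.Units_closed)
  have sum: "h (a \<oplus> b) = u \<otimes>\<^bsub>S\<^esub> (x \<oplus>\<^bsub>S\<^esub> y)"
    using ab xy uc by (simp add: eq S.r_distr)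
  have minus: "h (a \<ominus> b) = u \<otimes>\<^bsub>S\<^esub> (x \<ominus>\<^bsub>S\<^esub> y)"
    unfolding hom_sub[OF ab] eq using xy uc by algebra
  \<comment> \<open>The difference of squares scales by the square of \<open>u\<close>, hence stays
    in \<open>J\<close>.\<close>
  have "h (a [^] (2::nat) \<ominus> b [^] (2::nat)) =
      (u \<otimes>\<^bsub>S\<^esub> u) \<otimes>\<^bsub>S\<^esub> (x [^]\<^bsub>S\<^esub> (2::nat) \<ominus>\<^bsub>S\<^esub> y [^]\<^bsub>S\<^esub> (2::nat))"
    using ab xy uc
    by (simp add: eq numeral_2_eq_2) algebra
  also have "\<dots> \<in> J"
    using diff uc by (simp add: J(1) ideal.I_l_closed)
  finally have "a \<oplus> b \<in> radical R {r \<in> carrier R. h r \<in> J} \<or>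
      a \<ominus> b \<in> {r \<in> carrier R. h r \<in> J}"
    using I ab by (simp add: sdf_absorbing_primary_def)
  \<comment> \<open>With \<open>hom_add\<close> active, \<open>h (a \<oplus> b)\<close> would be
    split before \<open>sum\<close> could rewrite it.\<close>
  then have "u \<otimes>\<^bsub>S\<^esub> (x \<oplus>\<^bsub>S\<^esub> y) \<in> radical S J \<or> u \<otimes>\<^bsub>S\<^esub> (x \<ominus>\<^bsub>S\<^esub> y) \<in> J"
    unfolding radical_vimage by (auto simp: sum minus simp del: hom_add)
  then show "x \<oplus>\<^bsub>S\<^esub> y \<in> radical S J \<or> x \<ominus>\<^bsub>S\<^esub> y \<in> J"
    using ideal.Units_mult_memD[OF J(1) u] ideal.Units_mult_memD[OF J(2) u] xy
    by (meson S.add.m_closed S.minus_closed)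
qed (fact J(1))

end

lemma (in cring_mult_subset) localization_common_denominator:
  assumes "x \<in> carrier (localization R S)" "y \<in> carrier (localization R S)"
  shows "\<exists>u\<in>Units (localization R S). \<exists>a\<in>carrier R. \<exists>b\<in>carrier R.
    u \<otimes>\<^bsub>localization R S\<^esub> x = loc_frac R S a \<one> \<and> u \<otimes>\<^bsub>localization R S\<^esub> y = loc_frac R S b \<one>"
proof -
  obtain a s b t where x: "x = loc_frac R S a s" "a \<in> carrier R" "s \<in> S"
    and y: "y = loc_frac R S b t" "b \<in> carrier R" "t \<in> S"
    using assms by (auto simp: carrier_localization)
  have c: "s \<in> carrier R" "t \<in> carrier R"
    using x y S_carrier by auto
  \<comment> \<open>The product of both denominators: it takes \<open>a/s\<close> to
    \<open>ta/1\<close> and \<open>b/t\<close> to \<open>sb/1\<close>, and is a unit because it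
    comes from \<open>S\<close>.\<close>
  let ?u = "loc_frac R S (s \<otimes> t) \<one>"
  have "?u \<otimes>\<^bsub>localization R S\<^esub> x = loc_frac R S (s \<otimes> t \<otimes> a) s"
    "?u \<otimes>\<^bsub>localization R S\<^esub> y = loc_frac R S (s \<otimes> t \<otimes> b) t"
    using x y c by (simp_all add: mult_frac)
  moreover have "loc_frac R S (s \<otimes> t \<otimes> a) s = loc_frac R S (t \<otimes> a) \<one>"
    using x y c by (intro frac_cong) (auto simp: m_ac)
  moreover have "loc_frac R S (s \<otimes> t \<otimes> b) t = loc_frac R S (s \<otimes> b) \<one>"
    using x y c by (intro frac_cong) (auto simp: m_ac)
  moreover have "?u \<in> Units (localization R S)"
    using x y by (intro Units_localization) simp
  ultimately show ?thesis
    using x(2) y(2) c by (metis cring_simprules(5))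
qed

theorem theorem4p2:
  fixes R :: "('a, 'b) ring_scheme"
  assumes "cring R"
    and "\<And>I. quasi_sdf_absorbing I R \<Longrightarrow> sdf_absorbing_primary I R"
  shows "\<forall>S. submonoid S R \<longrightarrow>
    (\<forall>J. quasi_sdf_absorbing J (localization R S) \<longrightarrow>
         sdf_absorbing_primary J (localization R S))"
proof (intro allI impI)
  fix S J
  assume S: "submonoid S R" and J: "quasi_sdf_absorbing J (localization R S)"
  interpret cring_mult_subset R S
    using assms(1) S by (rule cring_mult_subset.intro)
  interpret loc: ring_hom_cring R "localization R S" "\<lambda>r. loc_frac R S r \<one>\<^bsub>R\<^esub>"
    using assms(1) cring_localization ring_hom_localization
    by (rule UnivPoly.ring_hom_cringI)
  show "sdf_absorbing_primary J (localization R S)"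
  proof (rule loc.sdf_absorbing_primary_if_vimage)
    \<comment> \<open>\<open>sdf_absorbing\<close> includes being an ideal, so the hypothesis on
      \<open>J\<close> already makes its radical one.\<close>
    show "ideal J (localization R S)" "ideal (radical (localization R S) J) (localization R S)"
      using J by (auto simp: quasi_sdf_absorbing_def sdf_absorbing_def)
    show "sdf_absorbing_primary {r \<in> carrier R. loc_frac R S r \<one>\<^bsub>R\<^esub> \<in> J} R"
      using J by (intro assms(2) loc.quasi_sdf_absorbing_vimage)
  qed (rule localization_common_denominator)
qed

end
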